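(* Let $H=(a_1,a_2)\subset\mathbb{R}$ be a bounded open interval, $\mathcal{B}$ a finite index set, and $m\ge 2$ an integer. Assume (H5.1): for each $b\in\mathcal{B}$, $g_b\in C^m(\bar H)$, $\theta_b\in C^m(\bar H)$, $g_b(x)>0$ on $\bar H$, $\theta_b(H)\subset H$; and there exist an integer $\mu\ge1$ and a real $\kappa<1$ with $|\theta_\omega(x)-\theta_\omega(y)|\le\kappa|x-y|$ for all $\omega\in\mathcal{B}_\mu$, $x,y\in\bar H$. Let $s>0$ be given and assume that $\theta_b'(u)\ge0$, $\theta_b''(u)\ge0$, $g_b'(u)\ge0$, $g_b''(u)\ge0$ and $$g_b''(u)g_b(u)-(1-s)[g_b'(u)]^2\ge0 \qquad ( * )$$ for all $b\in\mathcal{B}$ and all $u\in H$. If $v_s$ is the strictly positive $C^m$ eigenfunction of $\Lambda_s$, then $v_s'(u)\ge0$ and $v_s''(u)\ge0$ for all $u\in\bar H$. If, in addition, there is a set $F\subset\bar H$ (possibly empty) such that for all $u\in\bar H\setminus F$ and all $b\in\mathcal{B}$, $g_b'(u)>0$ and strict inequality holds in $( * )$, then $v_s'(u)>0$ and $v_s''(u)>0$ for all $u\in\bar H\setminus F$.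
   Context: For $\nu\ge1$, $\mathcal{B}_\nu=\{(b_1,\dots,b_\nu): b_j\in\mathcal{B}\}$, $\theta_\omega=\theta_{b_\nu}\circ\cdots\circ\theta_{b_1}$ for $\omega=(b_1,\dots,b_\nu)$. For $s\ge0$, $L_s:C(\bar H)\to C(\bar H)$ is $(L_sw)(x)=\sum_{b\in\mathcal{B}}[g_b(x)]^s w(\theta_b(x))$, and $\Lambda_s$ is its restriction to the Banach space $C^m(\bar H)$. $\Lambda_s$ has a strictly positive eigenfunction $v_s\in C^m(\bar H)$, unique up to positive scalar multiples, with eigenvalue the spectral radius $r(\Lambda_s)$. *)

theory Defs
  imports "HOL-Analysis.Analysis"
begin

text \<open>
  Derivatives are taken within the set \<open>S\<close>.  For a closed interval \<open>S\<close> they are the ordinary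
  derivatives at interior points and the one-sided ones at the endpoints; for a \<open>C\<^sup>m\<close> function the
  latter are the continuous extensions of the derivatives from the open interval.
\<close>

primrec nth_deriv_on ::
  "real set \<Rightarrow> nat \<Rightarrow> (real \<Rightarrow> 'a::real_normed_vector) \<Rightarrow> real \<Rightarrow> 'a" where
  "nth_deriv_on S 0 f = f"
| "nth_deriv_on S (Suc k) f = (\<lambda>x. vector_derivative (nth_deriv_on S k f) (at x within S))"

definition Cm_space :: "real set \<Rightarrow> nat \<Rightarrow> (real \<Rightarrow> 'a::real_normed_vector) set" where
  "Cm_space S m = {f. (\<forall>k<m. nth_deriv_on S k f differentiable_on S) \<and>
                      continuous_on S (nth_deriv_on S m f)}"

definition Cm_norm :: "real set \<Rightarrow> nat \<Rightarrow> (real \<Rightarrow> 'a::real_normed_vector) \<Rightarrow> real" where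
  "Cm_norm S m f = Max ((\<lambda>k. SUP x\<in>S. norm (nth_deriv_on S k f x)) ` {..m})"

text \<open>
  The spectrum of an operator on \<open>C\<^sup>m(S)\<close> is that of its complexification, which acts on the
  complex-valued \<open>C\<^sup>m\<close> functions: \<open>z\<close> is outside the spectrum iff \<open>z - T\<close> is bijective with bounded
  inverse.  Only the values on \<open>S\<close> of an element of \<open>Cm_space S m\<close> matter, so equality of elements
  is equality on \<open>S\<close>.
\<close>

definition Cm_resolvent_set ::
  "real set \<Rightarrow> nat \<Rightarrow> ((real \<Rightarrow> complex) \<Rightarrow> real \<Rightarrow> complex) \<Rightarrow> complex set" where
  "Cm_resolvent_set S m T =
     {z. \<exists>C. \<forall>f\<in>Cm_space S m. \<exists>w\<in>Cm_space S m.
           (\<forall>x\<in>S. z * w x - T w x = f x) \<and> Cm_norm S m w \<le> C * Cm_norm S m f \<and>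
           (\<forall>w'\<in>Cm_space S m. (\<forall>x\<in>S. z * w' x - T w' x = f x) \<longrightarrow> (\<forall>x\<in>S. w' x = w x))}"

definition Cm_spectral_radius ::
  "real set \<Rightarrow> nat \<Rightarrow> ((real \<Rightarrow> complex) \<Rightarrow> real \<Rightarrow> complex) \<Rightarrow> real" where
  "Cm_spectral_radius S m T = (SUP z\<in>- Cm_resolvent_set S m T. cmod z)"

text \<open>
  The operator is polymorphic in the values of \<open>w\<close>: at type \<open>real\<close> it is the operator \<open>L\<^sub>s\<close> itself,
  at type \<open>complex\<close> its complexification.
\<close>

definition transfer_op ::
  "'b set \<Rightarrow> ('b \<Rightarrow> real \<Rightarrow> real) \<Rightarrow> ('b \<Rightarrow> real \<Rightarrow> real) \<Rightarrow> real \<Rightarrow>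
   (real \<Rightarrow> 'a::real_normed_vector) \<Rightarrow> real \<Rightarrow> 'a" where
  "transfer_op B g \<theta> s w x = (\<Sum>b\<in>B. (g b x powr s) *\<^sub>R w (\<theta> b x))"

definition words :: "'b set \<Rightarrow> nat \<Rightarrow> 'b list set" where
  "words B n = {\<omega>. length \<omega> = n \<and> set \<omega> \<subseteq> B}"

text \<open>\<open>fold\<close> applies the map of the first letter first: the composite is
  \<open>\<theta> b\<^sub>n \<circ> \<dots> \<circ> \<theta> b\<^sub>1\<close> for \<open>\<omega> = [b\<^sub>1, \<dots>, b\<^sub>n]\<close>.\<close>

definition word_map :: "('b \<Rightarrow> real \<Rightarrow> real) \<Rightarrow> 'b list \<Rightarrow> real \<Rightarrow> real" where
  "word_map \<theta> \<omega> = fold \<theta> \<omega>"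

end

theory Submission
  imports Defs
begin

text \<open>
  Write \<open>h\<^sub>b = g\<^sub>b\<^sup>s\<close>; condition \<open>(*)\<close> says exactly that \<open>h\<^sub>b'' \<ge> 0\<close>.  The only property of the
  eigenvalue that matters is its positivity, which is immediate from \<open>v > 0\<close>.  Differentiating
  \<open>\<lambda> v = (\<Sum>b. h\<^sub>b (v \<circ> \<theta>\<^sub>b))\<close> once, and once more when \<open>v' \<ge> 0\<close> is known, and dropping nonnegative terms
  shows that \<open>f = v'\<close> (with \<open>j = 1\<close>) and then \<open>f = v''\<close> (with \<open>j = 2\<close>) satisfy
  \<open>\<lambda> f \<ge> (\<Sum>b. h\<^sub>b (\<theta>\<^sub>b')\<^sup>j (f \<circ> \<theta>\<^sub>b))\<close>.  As the \<open>\<mu>\<close>-fold compositions contract, comparing \<open>f\<close> with \<open>v\<close>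
  at a minimum point of \<open>f / v\<close> gives \<open>f \<ge> 0\<close>.  Strictness comes from the dropped terms.
\<close>

section \<open>Differentiation within a closed interval\<close>

lemma Cm_space_second_derivative:
  fixes f :: "real \<Rightarrow> real"
  assumes f: "f \<in> Cm_space S m" and m: "m \<ge> 2"
  shows "\<And>x. x \<in> S \<Longrightarrow> (f has_real_derivative nth_deriv_on S 1 f x) (at x within S)"
    and "\<And>x. x \<in> S \<Longrightarrow>
      (nth_deriv_on S 1 f has_real_derivative nth_deriv_on S 2 f x) (at x within S)"
    and "continuous_on S (nth_deriv_on S 2 f)"
proof -
  have step: "(nth_deriv_on S k f has_real_derivative nth_deriv_on S (Suc k) f x) (at x within S)"
    if "k < m" "x \<in> S" for k x
  proof -
    have "nth_deriv_on S k f differentiable (at x within S)"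
      using f that by (auto simp: Cm_space_def differentiable_on_def)
    then show ?thesis
      by (simp add: has_real_derivative_iff_has_vector_derivative vector_derivative_works)
  qed
  show "(f has_real_derivative nth_deriv_on S 1 f x) (at x within S)" if "x \<in> S" for x
    using step[of 0 x] that m by simp
  show "(nth_deriv_on S 1 f has_real_derivative nth_deriv_on S 2 f x) (at x within S)"
    if "x \<in> S" for x
    using step[of 1 x] that m by (simp only: Suc_1)
  show "continuous_on S (nth_deriv_on S 2 f)"
  proof (cases "m = 2")
    case True
    then show ?thesis using f by (simp add: Cm_space_def)
  next
    case False
    then show ?thesis
      using f m by (intro differentiable_imp_continuous_on) (simp add: Cm_space_def)
  qed
qed

text \<open>The sign conditions are given on the open interval only, but the minimum point used
  later may be an endpoint. Density of the interior and continuity carry them over.\<close>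

lemma continuous_nonneg_on_closed_interval:
  fixes f :: "real \<Rightarrow> real"
  assumes "a < b" "continuous_on {a..b} f" "\<And>x. x \<in> {a<..<b} \<Longrightarrow> f x \<ge> 0" "x \<in> {a..b}"
  shows "f x \<ge> 0"
  using continuous_ge_on_closure[of "{a<..<b}" f x 0] assms by simp

lemma maps_closed_interval:
  fixes f :: "real \<Rightarrow> real"
  assumes "a < b" "continuous_on {a..b} f" "f ` {a<..<b} \<subseteq> {a<..<b}"
  shows "f ` {a..b} \<subseteq> {a..b}"
proof -
  have "f ` {a<..<b} \<subseteq> {a..b}"
    using assms(3) greaterThanLessThan_subseteq_atLeastAtMost_iff[of a b a b] by blast
  then have "f ` closure {a<..<b} \<subseteq> {a..b}"
    using assms by (intro image_closure_subset) auto
  then show ?thesis using assms(1) by simp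
qed

lemma has_real_derivative_powr_twice:
  fixes g g1 :: "real \<Rightarrow> real"
  assumes pos: "\<And>y. y \<in> S \<Longrightarrow> g y > 0"
    and g: "\<And>y. y \<in> S \<Longrightarrow> (g has_real_derivative g1 y) (at y within S)"
    and g1: "(g1 has_real_derivative g2) (at x within S)"
    and x: "x \<in> S"
  shows "((\<lambda>y. g y powr s) has_real_derivative s * g x powr (s - 1) * g1 x) (at x within S)"
    and "((\<lambda>y. s * g y powr (s - 1) * g1 y) has_real_derivative
           s * g x powr (s - 2) * (g2 * g x - (1 - s) * (g1 x)\<^sup>2)) (at x within S)"
proof -
  have powr: "((\<lambda>y. g y powr r) has_real_derivative r * g x powr (r - 1) * g1 x) (at x within S)"
    for r
    by (rule has_real_derivative_powr[THEN DERIV_chain2, OF pos[OF x] g[OF x]])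
  show "((\<lambda>y. g y powr s) has_real_derivative s * g x powr (s - 1) * g1 x) (at x within S)"
    by (rule powr)
  have split: "g x powr (s - 1) = g x powr (s - 2) * g x"
    using powr_add[of "g x" "s - 2" 1] pos[OF x] by simp
  show "((\<lambda>y. s * g y powr (s - 1) * g1 y) has_real_derivative
           s * g x powr (s - 2) * (g2 * g x - (1 - s) * (g1 x)\<^sup>2)) (at x within S)"
    by (rule derivative_eq_intros powr g1 refl)+
       (simp add: split power2_eq_square algebra_simps)
qed

text \<open>Serves both differentiations of the eigenvalue equation: first with \<open>f\<close> the
  eigenfunction, then also with \<open>f\<close> its derivative and weights that contain the
  derivative of \<open>\<theta> b\<close>.\<close>

lemma has_real_derivative_weighted_sum:
  fixes p \<theta> :: "'b \<Rightarrow> real \<Rightarrow> real"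
  assumes p: "\<And>b. b \<in> B \<Longrightarrow> (p b has_real_derivative p' b x) (at x within S)"
    and \<theta>: "\<And>b. b \<in> B \<Longrightarrow> (\<theta> b has_real_derivative \<theta>' b x) (at x within S)"
    and f: "\<And>y. y \<in> S \<Longrightarrow> (f has_real_derivative f' y) (at y within S)"
    and maps: "\<And>b. b \<in> B \<Longrightarrow> \<theta> b ` S \<subseteq> S"
    and x: "x \<in> S"
  shows "((\<lambda>y. \<Sum>b\<in>B. p b y * f (\<theta> b y)) has_real_derivative
           (\<Sum>b\<in>B. p' b x * f (\<theta> b x) + p b x * \<theta>' b x * f' (\<theta> b x))) (at x within S)"
proof (rule DERIV_sum)
  fix b assume b: "b \<in> B"
  \<comment> \<open>The chain rule asks for the derivative of \<open>f\<close> within the image of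
    \<open>S\<close>, which invariance places inside \<open>S\<close>.\<close>
  have "(f has_real_derivative f' (\<theta> b x)) (at (\<theta> b x) within \<theta> b ` S)"
    using f maps[OF b] x by (blast intro: has_field_derivative_subset)
  from DERIV_image_chain[OF this \<theta>[OF b]]
  have "((\<lambda>y. f (\<theta> b y)) has_real_derivative f' (\<theta> b x) * \<theta>' b x) (at x within S)"
    by (simp add: o_def)
  from DERIV_mult[OF p[OF b] this]
  show "((\<lambda>y. p b y * f (\<theta> b y)) has_real_derivative
           p' b x * f (\<theta> b x) + p b x * \<theta>' b x * f' (\<theta> b x)) (at x within S)"
    by (simp add: algebra_simps)
qed

text \<open>Nondegeneracy of the interval makes one-sided derivatives at the endpoints unique too.
  This allows the derivatives of the two sides of the eigenvalue equation to be equated on the whole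
  closed interval.\<close>

lemma has_real_derivative_unique_interval:
  fixes f :: "real \<Rightarrow> real"
  assumes "a < b" "x \<in> {a..b}"
    and "(f has_real_derivative c) (at x within {a..b})"
    and "(f has_real_derivative d) (at x within {a..b})"
  shows "c = d"
  using vector_derivative_unique_within_closed_interval[of a b x f c d] assms
  by (simp add: has_real_derivative_iff_has_vector_derivative)

text \<open>Every difference quotient at \<open>x\<close> is at most \<open>K\<close>, hence so is
  its limit. Applied to the map of a word, it turns contraction into a bound on the
  derivative.\<close>

lemma has_real_derivative_le_lipschitz:
  fixes f :: "real \<Rightarrow> real"
  assumes ab: "a < b" "x \<in> {a..b}" and f: "(f has_real_derivative d) (at x within {a..b})"
    and lip: "\<And>y. y \<in> {a..b} \<Longrightarrow> \<bar>f y - f x\<bar> \<le> K * \<bar>y - x\<bar>"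
  shows "d \<le> K"
proof (rule tendsto_upperbound)
  show "((\<lambda>y. (f y - f x) / (y - x)) \<longlongrightarrow> d) (at x within {a..b})"
    using f by (simp add: has_field_derivative_iff)
  show "at x within {a..b} \<noteq> bot"
    using ab by (simp add: trivial_limit_within islimpt_Icc)
  show "\<forall>\<^sub>F y in at x within {a..b}. (f y - f x) / (y - x) \<le> K"
  proof (subst eventually_at_filter, rule always_eventually, intro allI impI)
    fix y assume "y \<noteq> x" "y \<in> {a..b}"
    then have "\<bar>(f y - f x) / (y - x)\<bar> \<le> K"
      using lip[of y] by (simp add: field_simps)
    then show "(f y - f x) / (y - x) \<le> K" by linarith
  qed
qed

section \<open>Words, cocycles and the minimum principle\<close>

lemma words_0: "words B 0 = {[]}"
  by (auto simp: words_def)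

lemma words_Suc: "words B (Suc n) = (\<lambda>(b, \<omega>). b # \<omega>) ` (B \<times> words B n)"
  by (force simp: words_def length_Suc_conv image_iff)

lemma sum_words_Suc:
  "(\<Sum>\<omega>\<in>words B (Suc n). F \<omega>) = (\<Sum>b\<in>B. \<Sum>\<omega>\<in>words B n. F (b # \<omega>))"
proof -
  have "inj_on (\<lambda>(b, \<omega>). b # \<omega>) (B \<times> words B n)"
    by (auto simp: inj_on_def)
  then show ?thesis
    by (simp add: words_Suc sum.reindex sum.cartesian_product case_prod_unfold)
qed

lemma word_map_simps:
  "word_map \<theta> [] x = x"
  "word_map \<theta> (b # \<omega>) x = word_map \<theta> \<omega> (\<theta> b x)"
  by (simp_all add: word_map_def)

text \<open>The product of the values of \<open>p\<close> along the orbit of \<open>x\<close> under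
  the word. For \<open>p\<close> the derivatives of the maps, the chain rule makes it the derivative
  of the word map; for \<open>p\<close> the weights of an operator, it is the weight of the word in
  an iterate.\<close>

primrec cocycle ::
  "('b \<Rightarrow> real \<Rightarrow> real) \<Rightarrow> ('b \<Rightarrow> real \<Rightarrow> real) \<Rightarrow> 'b list \<Rightarrow> real \<Rightarrow> real" where
  "cocycle \<theta> p [] x = 1"
| "cocycle \<theta> p (b # \<omega>) x = p b x * cocycle \<theta> p \<omega> (\<theta> b x)"

text \<open>Separates the weight of a word into that of the original operator and a power of the
  derivative of the word map, to which contraction applies.\<close>

lemma cocycle_mult_power:
  "cocycle \<theta> (\<lambda>b x. p b x * q b x ^ j) \<omega> x = cocycle \<theta> p \<omega> x * cocycle \<theta> q \<omega> x ^ j"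
  by (induction \<omega> arbitrary: x) (simp_all add: power_mult_distrib)

locale function_system =
  fixes B :: "'b set" and S :: "real set" and \<theta> :: "'b \<Rightarrow> real \<Rightarrow> real"
  assumes maps: "\<And>b. b \<in> B \<Longrightarrow> \<theta> b ` S \<subseteq> S"
begin

lemma word_map_mem:
  assumes "set \<omega> \<subseteq> B" "x \<in> S" shows "word_map \<theta> \<omega> x \<in> S"
  using assms maps by (induction \<omega> arbitrary: x) (auto simp: word_map_simps)

lemma cocycle_nonneg:
  assumes "\<And>b x. b \<in> B \<Longrightarrow> x \<in> S \<Longrightarrow> p b x \<ge> 0" "set \<omega> \<subseteq> B" "x \<in> S"
  shows "cocycle \<theta> p \<omega> x \<ge> 0"
  using assms(2,3)
proof (induction \<omega> arbitrary: x)
  case (Cons b \<omega>)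
  then have "\<theta> b x \<in> S" using maps by auto
  with Cons assms(1) show ?case by simp
qed simp

lemma word_map_has_real_derivative:
  assumes \<theta>: "\<And>b x. b \<in> B \<Longrightarrow> x \<in> S \<Longrightarrow> (\<theta> b has_real_derivative \<theta>' b x) (at x within S)"
    and "set \<omega> \<subseteq> B" "x \<in> S"
  shows "(word_map \<theta> \<omega> has_real_derivative cocycle \<theta> \<theta>' \<omega> x) (at x within S)"
  using assms(2,3)
proof (induction \<omega> arbitrary: x)
  case Nil
  then show ?case by (simp add: word_map_def id_def)
next
  case (Cons b \<omega>)
  then have b: "b \<in> B" and "\<theta> b x \<in> S" using maps by auto
  with Cons have "(word_map \<theta> \<omega> has_real_derivative cocycle \<theta> \<theta>' \<omega> (\<theta> b x))
      (at (\<theta> b x) within \<theta> b ` S)"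
    using maps[OF b] by (auto intro: has_field_derivative_subset)
  from DERIV_image_chain[OF this \<theta>[OF b Cons.prems(2)]]
  show ?case by (simp add: word_map_def o_def mult.commute)
qed

text \<open>Nonnegative weights make the operator monotone, so the inequality can be iterated;
  \<open>f\<close> itself may change sign.\<close>

lemma iterate_subsolution:
  assumes p: "\<And>b x. b \<in> B \<Longrightarrow> x \<in> S \<Longrightarrow> p b x \<ge> 0" and l: "l \<ge> 0"
    and sub: "\<And>x. x \<in> S \<Longrightarrow> (\<Sum>b\<in>B. p b x * f (\<theta> b x)) \<le> l * f x"
    and x: "x \<in> S"
  shows "(\<Sum>\<omega>\<in>words B n. cocycle \<theta> p \<omega> x * f (word_map \<theta> \<omega> x)) \<le> l ^ n * f x"
  using x
proof (induction n arbitrary: x)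
  case 0
  then show ?case by (simp add: words_0 word_map_simps)
next
  case (Suc n)
  \<comment> \<open>Splitting off the first letter leaves the \<open>n\<close>-th iterate evaluated
    at \<open>\<theta> b x\<close>, where the induction hypothesis applies.\<close>
  have "(\<Sum>\<omega>\<in>words B (Suc n). cocycle \<theta> p \<omega> x * f (word_map \<theta> \<omega> x)) =
      (\<Sum>b\<in>B. p b x * (\<Sum>\<omega>\<in>words B n. cocycle \<theta> p \<omega> (\<theta> b x) * f (word_map \<theta> \<omega> (\<theta> b x))))"
    by (simp add: sum_words_Suc word_map_simps sum_distrib_left mult.assoc)
  also have "\<dots> \<le> (\<Sum>b\<in>B. p b x * (l ^ n * f (\<theta> b x)))"
    using maps Suc p by (intro sum_mono mult_left_mono) auto
  also have "\<dots> = l ^ n * (\<Sum>b\<in>B. p b x * f (\<theta> b x))"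
    by (simp add: sum_distrib_left algebra_simps)
  also have "\<dots> \<le> l ^ n * (l * f x)"
    using sub Suc.prems l by (intro mult_left_mono) auto
  finally show ?case by (simp add: algebra_simps)
qed

end

text \<open>
  A negative minimum \<open>q\<close> of \<open>f / v\<close> would satisfy \<open>q \<ge> \<kappa>\<^sup>j q\<close>, because the weights of the
  \<open>n\<close>-th iterate carry the extra factor \<open>(\<theta>\<^sub>\<omega>')\<^sup>j \<le> \<kappa>\<^sup>j < 1\<close>.
\<close>

lemma minimum_principle:
  fixes h \<theta> \<theta>' :: "'b \<Rightarrow> real \<Rightarrow> real" and v f :: "real \<Rightarrow> real"
  assumes ab: "a < b"
    and maps: "\<And>c. c \<in> B \<Longrightarrow> \<theta> c ` {a..b} \<subseteq> {a..b}"
    and h: "\<And>c x. c \<in> B \<Longrightarrow> x \<in> {a..b} \<Longrightarrow> h c x \<ge> 0"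
    and \<theta>: "\<And>c x. c \<in> B \<Longrightarrow> x \<in> {a..b} \<Longrightarrow>
          (\<theta> c has_real_derivative \<theta>' c x) (at x within {a..b})"
    and \<theta>'_nonneg: "\<And>c x. c \<in> B \<Longrightarrow> x \<in> {a..b} \<Longrightarrow> \<theta>' c x \<ge> 0"
    and contr: "\<And>\<omega> x y. \<omega> \<in> words B n \<Longrightarrow> x \<in> {a..b} \<Longrightarrow> y \<in> {a..b} \<Longrightarrow>
          \<bar>word_map \<theta> \<omega> x - word_map \<theta> \<omega> y\<bar> \<le> \<kappa> * \<bar>x - y\<bar>"
    and \<kappa>: "0 \<le> \<kappa>" "\<kappa> < 1" and l: "l > 0" and j: "j > 0"
    and v_cont: "continuous_on {a..b} v" and v_pos: "\<And>x. x \<in> {a..b} \<Longrightarrow> v x > 0"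
    and f_cont: "continuous_on {a..b} f"
    and v_sub: "\<And>x. x \<in> {a..b} \<Longrightarrow> (\<Sum>c\<in>B. h c x * v (\<theta> c x)) \<le> l * v x"
    and f_sub: "\<And>x. x \<in> {a..b} \<Longrightarrow> (\<Sum>c\<in>B. h c x * \<theta>' c x ^ j * f (\<theta> c x)) \<le> l * f x"
    and x: "x \<in> {a..b}"
  shows "f x \<ge> 0"
proof -
  interpret function_system B "{a..b}" \<theta>
    by standard (rule maps)
  have "continuous_on {a..b} (\<lambda>x. f x / v x)"
    using v_pos by (intro continuous_intros f_cont v_cont) force
  then obtain z where z: "z \<in> {a..b}" and min: "\<And>y. y \<in> {a..b} \<Longrightarrow> f z / v z \<le> f y / v y"
    using continuous_attains_inf[of "{a..b}" "\<lambda>x. f x / v x"] ab by auto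
  define q where "q = f z / v z"
  have fz: "f z = q * v z"
    using v_pos[OF z] by (simp add: q_def)
  have f_ge: "f y \<ge> q * v y" if "y \<in> {a..b}" for y
    using min[OF that] v_pos[OF that] by (simp add: q_def pos_le_divide_eq)
  have "q \<ge> 0"
  proof (rule ccontr)
    assume "\<not> q \<ge> 0"
    then have q: "q < 0" by simp
    \<comment> \<open>Since \<open>q * \<kappa> ^ j\<close> is not positive, multiplying by it turns
      the upper bound for the iterate of \<open>v\<close> into a lower bound.\<close>
    have "q * \<kappa> ^ j * (l ^ n * v z) \<le>
        q * \<kappa> ^ j * (\<Sum>\<omega>\<in>words B n. cocycle \<theta> h \<omega> z * v (word_map \<theta> \<omega> z))"
      using iterate_subsolution[of h l v, OF h _ v_sub z] l q \<kappa>(1)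
      by (intro mult_left_mono_neg) (auto simp: mult_nonpos_nonneg)
    also have "\<dots> = (\<Sum>\<omega>\<in>words B n. q * (\<kappa> ^ j * (cocycle \<theta> h \<omega> z * v (word_map \<theta> \<omega> z))))"
      by (simp add: sum_distrib_left mult.assoc)
    also have "\<dots> \<le> (\<Sum>\<omega>\<in>words B n.
        cocycle \<theta> (\<lambda>c x. h c x * \<theta>' c x ^ j) \<omega> z * f (word_map \<theta> \<omega> z))"
    \<comment> \<open>Word by word: replacing \<open>\<kappa> ^ j\<close> by the smaller power of
      the derivative raises the negative term, and then \<open>q * v\<close> is replaced by the
      larger \<open>f\<close>.\<close>
    proof (rule sum_mono)
      fix \<omega> assume \<omega>: "\<omega> \<in> words B n"
      then have sub: "set \<omega> \<subseteq> B" by (simp add: words_def)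
      have mem: "word_map \<theta> \<omega> z \<in> {a..b}"
        by (rule word_map_mem[OF sub z])
      have nonneg: "cocycle \<theta> h \<omega> z \<ge> 0" "cocycle \<theta> \<theta>' \<omega> z \<ge> 0"
        using cocycle_nonneg[OF _ sub z] h \<theta>'_nonneg by blast+
      have "cocycle \<theta> \<theta>' \<omega> z \<le> \<kappa>"
        using has_real_derivative_le_lipschitz[OF ab z word_map_has_real_derivative[OF \<theta> sub z]]
          contr[OF \<omega> _ z] by blast
      then have "cocycle \<theta> \<theta>' \<omega> z ^ j \<le> \<kappa> ^ j"
        using nonneg by (intro power_mono)
      then have "cocycle \<theta> \<theta>' \<omega> z ^ j * (cocycle \<theta> h \<omega> z * v (word_map \<theta> \<omega> z)) \<le>
          \<kappa> ^ j * (cocycle \<theta> h \<omega> z * v (word_map \<theta> \<omega> z))"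
        using nonneg v_pos[OF mem] by (intro mult_right_mono) auto
      then have "q * (\<kappa> ^ j * (cocycle \<theta> h \<omega> z * v (word_map \<theta> \<omega> z))) \<le>
          q * (cocycle \<theta> \<theta>' \<omega> z ^ j * (cocycle \<theta> h \<omega> z * v (word_map \<theta> \<omega> z)))"
        using q by (intro mult_left_mono_neg) auto
      also have "\<dots> = cocycle \<theta> h \<omega> z * cocycle \<theta> \<theta>' \<omega> z ^ j * (q * v (word_map \<theta> \<omega> z))"
        by (simp add: algebra_simps)
      also have "\<dots> \<le> cocycle \<theta> h \<omega> z * cocycle \<theta> \<theta>' \<omega> z ^ j * f (word_map \<theta> \<omega> z)"
        using f_ge[OF mem] nonneg by (intro mult_left_mono) auto
      finally show "q * (\<kappa> ^ j * (cocycle \<theta> h \<omega> z * v (word_map \<theta> \<omega> z))) \<le>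
          cocycle \<theta> (\<lambda>c x. h c x * \<theta>' c x ^ j) \<omega> z * f (word_map \<theta> \<omega> z)"
        by (simp add: cocycle_mult_power)
    qed
    also have "\<dots> \<le> l ^ n * f z"
      using h \<theta>'_nonneg l by (intro iterate_subsolution f_sub z) auto
    also have "\<dots> = q * (l ^ n * v z)"
      by (simp add: fz)
    \<comment> \<open>The factor \<open>l ^ n * v z\<close> is positive and cancels. Dividing by
      \<open>q < 0\<close> would give \<open>\<kappa> ^ j \<ge> 1\<close>.\<close>
    finally have "q * \<kappa> ^ j \<le> q * 1"
      using l v_pos[OF z] mult_right_le_imp_le[of "q * \<kappa> ^ j" "l ^ n * v z" q] by simp
    moreover have "\<kappa> ^ j < 1"
      using \<kappa> j by (simp add: power_less_one_iff)
    ultimately show False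
      using q by (simp add: mult_le_cancel_left_neg)
  qed
  then show ?thesis
    using f_ge[OF x] v_pos[OF x] by (smt (verit) mult_nonneg_nonneg)
qed

section \<open>Signs of the derivatives of the eigenfunction\<close>

theorem theorem5p4:
  fixes a1 a2 s \<kappa> :: real and B :: "'b set" and m \<mu> :: nat
    and g \<theta> :: "'b \<Rightarrow> real \<Rightarrow> real" and v :: "real \<Rightarrow> real"
  assumes "a1 < a2" and "finite B" and "B \<noteq> {}" and "m \<ge> 2"
    and "\<And>b. b \<in> B \<Longrightarrow> g b \<in> Cm_space {a1..a2} m"
    and "\<And>b. b \<in> B \<Longrightarrow> \<theta> b \<in> Cm_space {a1..a2} m"
    and "\<And>b x. b \<in> B \<Longrightarrow> x \<in> {a1..a2} \<Longrightarrow> g b x > 0"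
    and "\<And>b. b \<in> B \<Longrightarrow> \<theta> b ` {a1<..<a2} \<subseteq> {a1<..<a2}"
    and "\<mu> \<ge> 1" and "\<kappa> < 1"
    and "\<And>\<omega> x y. \<omega> \<in> words B \<mu> \<Longrightarrow> x \<in> {a1..a2} \<Longrightarrow> y \<in> {a1..a2} \<Longrightarrow>
           \<bar>word_map \<theta> \<omega> x - word_map \<theta> \<omega> y\<bar> \<le> \<kappa> * \<bar>x - y\<bar>"
    and "s > 0"
    and "\<And>b u. b \<in> B \<Longrightarrow> u \<in> {a1<..<a2} \<Longrightarrow> nth_deriv_on {a1..a2} 1 (\<theta> b) u \<ge> 0"
    and "\<And>b u. b \<in> B \<Longrightarrow> u \<in> {a1<..<a2} \<Longrightarrow> nth_deriv_on {a1..a2} 2 (\<theta> b) u \<ge> 0"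
    and "\<And>b u. b \<in> B \<Longrightarrow> u \<in> {a1<..<a2} \<Longrightarrow> nth_deriv_on {a1..a2} 1 (g b) u \<ge> 0"
    and "\<And>b u. b \<in> B \<Longrightarrow> u \<in> {a1<..<a2} \<Longrightarrow> nth_deriv_on {a1..a2} 2 (g b) u \<ge> 0"
    and "\<And>b u. b \<in> B \<Longrightarrow> u \<in> {a1<..<a2} \<Longrightarrow>
           nth_deriv_on {a1..a2} 2 (g b) u * g b u
             - (1 - s) * (nth_deriv_on {a1..a2} 1 (g b) u)\<^sup>2 \<ge> 0"
    and "v \<in> Cm_space {a1..a2} m"
    and "\<And>x. x \<in> {a1..a2} \<Longrightarrow> v x > 0"
    and "\<And>x. x \<in> {a1..a2} \<Longrightarrow>
           transfer_op B g \<theta> s v x =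
             Cm_spectral_radius {a1..a2} m (transfer_op B g \<theta> s) * v x"
  shows "(\<forall>u\<in>{a1..a2}. nth_deriv_on {a1..a2} 1 v u \<ge> 0 \<and> nth_deriv_on {a1..a2} 2 v u \<ge> 0) \<and>
         (\<forall>F\<subseteq>{a1..a2}.
            (\<forall>u\<in>{a1..a2} - F. \<forall>b\<in>B.
               nth_deriv_on {a1..a2} 1 (g b) u > 0 \<and>
               nth_deriv_on {a1..a2} 2 (g b) u * g b u
                 - (1 - s) * (nth_deriv_on {a1..a2} 1 (g b) u)\<^sup>2 > 0) \<longrightarrow>
            (\<forall>u\<in>{a1..a2} - F.
               nth_deriv_on {a1..a2} 1 v u > 0 \<and> nth_deriv_on {a1..a2} 2 v u > 0))"
proof -
  note ab = assms(1) and m = assms(4) and pos = assms(7) and s = assms(12) and v_pos = assms(19)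
  define I where "I = {a1..a2}"
  define D1 :: "(real \<Rightarrow> real) \<Rightarrow> real \<Rightarrow> real" where "D1 = nth_deriv_on I 1"
  define D2 :: "(real \<Rightarrow> real) \<Rightarrow> real \<Rightarrow> real" where "D2 = nth_deriv_on I 2"
  define l where "l = Cm_spectral_radius I m (transfer_op B g \<theta> s)"
  note g = Cm_space_second_derivative[OF assms(5) m, folded I_def, folded D1_def D2_def]
  note \<theta> = Cm_space_second_derivative[OF assms(6) m, folded I_def, folded D1_def D2_def]
  note v = Cm_space_second_derivative[OF assms(18) m, folded I_def, folded D1_def D2_def]
  have closed_nonneg: "f x \<ge> 0"
    if "continuous_on I f" "\<And>x. x \<in> {a1<..<a2} \<Longrightarrow> f x \<ge> 0" "x \<in> I" for f :: "real \<Rightarrow> real" and x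
    using continuous_nonneg_on_closed_interval[OF ab] that unfolding I_def by blast
  have cont: "continuous_on I (g b)" "continuous_on I (D1 (g b))"
    "continuous_on I (\<theta> b)" "continuous_on I (D1 (\<theta> b))" if "b \<in> B" for b
    by (rule DERIV_continuous_on, erule g[OF that] \<theta>[OF that])+
  have v_cont: "continuous_on I v" "continuous_on I (D1 v)"
    by (rule DERIV_continuous_on, erule v)+
  have maps: "\<theta> b ` I \<subseteq> I" if "b \<in> B" for b
    using maps_closed_interval[OF ab] cont(3)[OF that] assms(8)[OF that] by (simp add: I_def)
  have mem: "\<theta> b x \<in> I" if "b \<in> B" "x \<in> I" for b x
    using maps that by auto
  \<comment> \<open>All four quantities are continuous on \<open>I\<close> because
    \<open>m \<ge> 2\<close>, so their signs extend to the endpoints.\<close>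
  have \<theta>1: "D1 (\<theta> b) x \<ge> 0" and \<theta>2: "D2 (\<theta> b) x \<ge> 0" and g1: "D1 (g b) x \<ge> 0"
    and disc: "D2 (g b) x * g b x - (1 - s) * (D1 (g b) x)\<^sup>2 \<ge> 0" if b: "b \<in> B" and x: "x \<in> I" for b x
  proof -
    note cont = cont[OF b] g(3)[OF b] \<theta>(3)[OF b]
    note nonneg = assms(13-15,17)[OF b, folded I_def, folded D1_def D2_def]
    show "D1 (\<theta> b) x \<ge> 0" "D2 (\<theta> b) x \<ge> 0" "D1 (g b) x \<ge> 0"
      by (rule closed_nonneg[OF _ _ x], rule cont, erule nonneg)+
    show "D2 (g b) x * g b x - (1 - s) * (D1 (g b) x)\<^sup>2 \<ge> 0"
      by (rule closed_nonneg[OF _ _ x], intro continuous_intros cont, erule nonneg)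
  qed

  define h where "h = (\<lambda>b x. g b x powr s)"
  define h1 where "h1 = (\<lambda>b x. s * g b x powr (s - 1) * D1 (g b) x)"
  define h2 where
    "h2 = (\<lambda>b x. s * g b x powr (s - 2) * (D2 (g b) x * g b x - (1 - s) * (D1 (g b) x)\<^sup>2))"
  have h_deriv: "(h b has_real_derivative h1 b x) (at x within I)"
    "(h1 b has_real_derivative h2 b x) (at x within I)" if b: "b \<in> B" and "x \<in> I" for b x
    unfolding h_def h1_def h2_def
    using has_real_derivative_powr_twice[OF pos[OF b, folded I_def] g(1)[OF b] g(2)[OF b]] that
    by auto
  have h_pos: "h b x > 0" if "b \<in> B" "x \<in> I" for b x
    using pos[OF that[unfolded I_def]] by (simp add: h_def)
  have h_nonneg: "h b x \<ge> 0" "h1 b x \<ge> 0" "h2 b x \<ge> 0" if "b \<in> B" "x \<in> I" for b x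
    using s that g1 disc by (auto simp: h_def h1_def h2_def)
  have vpos: "v x > 0" if "x \<in> I" for x
    using v_pos that by (simp add: I_def)

  have eigen: "l * v x = (\<Sum>b\<in>B. h b x * v (\<theta> b x))" if "x \<in> I" for x
    using assms(20) that by (simp add: I_def l_def h_def transfer_op_def)
  have a1: "a1 \<in> I" using ab by (simp add: I_def)
  \<comment> \<open>The eigenvalue equation at the single point \<open>a1\<close> gives
    \<open>l > 0\<close>: its right side is a nonempty sum of positive terms.\<close>
  have "(\<Sum>b\<in>B. h b a1 * v (\<theta> b a1)) > 0"
    using assms(2,3) h_pos mem vpos a1 by (intro sum_pos) auto
  then have l: "l > 0"
    using eigen[OF a1] vpos[OF a1] by (metis zero_less_mult_pos2)

  have eigen1: "l * D1 v x =
      (\<Sum>b\<in>B. h1 b x * v (\<theta> b x)) + (\<Sum>b\<in>B. h b x * D1 (\<theta> b) x * D1 v (\<theta> b x))"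
    if x: "x \<in> I" for x
  proof -
    \<comment> \<open>The two sides agree on all of \<open>I\<close>, so the radius
      \<open>d = 1\<close> is arbitrary.\<close>
    have "((\<lambda>y. \<Sum>b\<in>B. h b y * v (\<theta> b y)) has_real_derivative l * D1 v x) (at x within I)"
      by (rule has_field_derivative_transform_within[where d = 1, OF DERIV_cmult[OF v(1)[OF x]]])
         (use x eigen in auto)
    moreover have "((\<lambda>y. \<Sum>b\<in>B. h b y * v (\<theta> b y)) has_real_derivative
        (\<Sum>b\<in>B. h1 b x * v (\<theta> b x) + h b x * D1 (\<theta> b) x * D1 v (\<theta> b x))) (at x within I)"
      by (intro has_real_derivative_weighted_sum h_deriv \<theta> v maps x)
    ultimately show ?thesis
      using has_real_derivative_unique_interval[OF ab] x
      unfolding I_def sum.distrib[symmetric] by blast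
  qed
  have eigen2: "l * D2 v x =
      (\<Sum>b\<in>B. h2 b x * v (\<theta> b x)
         + (2 * h1 b x * D1 (\<theta> b) x + h b x * D2 (\<theta> b) x) * D1 v (\<theta> b x))
      + (\<Sum>b\<in>B. h b x * (D1 (\<theta> b) x)\<^sup>2 * D2 v (\<theta> b x))"
    if x: "x \<in> I" for x
  proof -
    have "((\<lambda>y. (\<Sum>b\<in>B. h1 b y * v (\<theta> b y)) + (\<Sum>b\<in>B. h b y * D1 (\<theta> b) y * D1 v (\<theta> b y)))
        has_real_derivative l * D2 v x) (at x within I)"
      by (rule has_field_derivative_transform_within[where d = 1, OF DERIV_cmult[OF v(2)[OF x]]])
         (use x eigen1 in auto)
    \<comment> \<open>The cross term \<open>h1 b x * D1 (\<theta> b) x * D1 v (\<theta> b x)\<close>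
      arises once from each sum, whence the factor 2 in \<open>eigen2\<close>.\<close>
    moreover have "((\<lambda>y. (\<Sum>b\<in>B. h1 b y * v (\<theta> b y)) + (\<Sum>b\<in>B. h b y * D1 (\<theta> b) y * D1 v (\<theta> b y)))
        has_real_derivative
          (\<Sum>b\<in>B. h2 b x * v (\<theta> b x) + h1 b x * D1 (\<theta> b) x * D1 v (\<theta> b x)) +
          (\<Sum>b\<in>B. (h1 b x * D1 (\<theta> b) x + D2 (\<theta> b) x * h b x) * D1 v (\<theta> b x)
             + h b x * D1 (\<theta> b) x * D1 (\<theta> b) x * D2 v (\<theta> b x))) (at x within I)"
      by (intro DERIV_add has_real_derivative_weighted_sum DERIV_mult h_deriv \<theta> v maps x)
    ultimately have "l * D2 v x =
        (\<Sum>b\<in>B. h2 b x * v (\<theta> b x) + h1 b x * D1 (\<theta> b) x * D1 v (\<theta> b x)) +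
        (\<Sum>b\<in>B. (h1 b x * D1 (\<theta> b) x + D2 (\<theta> b) x * h b x) * D1 v (\<theta> b x)
           + h b x * D1 (\<theta> b) x * D1 (\<theta> b) x * D2 v (\<theta> b x))"
      using has_real_derivative_unique_interval[OF ab] x unfolding I_def by blast
    then show ?thesis
      by (simp add: sum.distrib[symmetric] power2_eq_square algebra_simps)
  qed

  \<comment> \<open>Only \<open>\<kappa> < 1\<close> is assumed. A constant word exists as
    \<open>B\<close> is nonempty, and its contraction estimate for the distinct points
    \<open>a1\<close> and \<open>a2\<close> forces the sign.\<close>
  have "\<kappa> \<ge> 0"
  proof -
    obtain b where "b \<in> B" using assms(3) by blast
    then have "replicate \<mu> b \<in> words B \<mu>" by (auto simp: words_def)
    from assms(11)[OF this, of a1 a2] ab have "0 \<le> \<kappa> * \<bar>a1 - a2\<bar>"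
      by (smt (verit) atLeastAtMost_iff)
    with ab show ?thesis by (simp add: zero_le_mult_iff)
  qed
  \<comment> \<open>The function \<open>f\<close> and the exponent \<open>j\<close> stay open, for
    use with both derivatives.\<close>
  note principle = minimum_principle[OF ab, folded I_def, where B = B and h = h and \<theta> = \<theta>
      and \<theta>' = "\<lambda>b. D1 (\<theta> b)" and v = v,
      OF maps h_nonneg(1) \<theta>(1) \<theta>1 assms(11)[folded I_def] \<open>\<kappa> \<ge> 0\<close> assms(10) l _ v_cont(1) vpos]
  have v1: "D1 v x \<ge> 0" if x: "x \<in> I" for x
  proof (rule principle[where f = "D1 v" and j = 1])
    show "(\<Sum>b\<in>B. h b x * D1 (\<theta> b) x ^ 1 * D1 v (\<theta> b x)) \<le> l * D1 v x" if x: "x \<in> I" for x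
    proof -
      have "(\<Sum>b\<in>B. h1 b x * v (\<theta> b x)) \<ge> 0"
        using h_nonneg vpos mem x by (intro sum_nonneg mult_nonneg_nonneg) (auto intro: less_imp_le)
      then show ?thesis using eigen1[OF x] by simp
    qed
  qed (use eigen v_cont x in auto)
  have rest: "(2 * h1 b x * D1 (\<theta> b) x + h b x * D2 (\<theta> b) x) * D1 v (\<theta> b x) \<ge> 0"
    if "b \<in> B" "x \<in> I" for b x
    using that mem by (intro mult_nonneg_nonneg add_nonneg_nonneg h_nonneg \<theta>1 \<theta>2 v1) auto
  have v2: "D2 v x \<ge> 0" if x: "x \<in> I" for x
  \<comment> \<open>For \<open>m = 2\<close>, continuity is all the regularity known for
    \<open>D2 v\<close>, and it is all that the principle asks of \<open>f\<close>.\<close>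
  proof (rule principle[where f = "D2 v" and j = 2])
    show "(\<Sum>b\<in>B. h b x * (D1 (\<theta> b) x)\<^sup>2 * D2 v (\<theta> b x)) \<le> l * D2 v x" if x: "x \<in> I" for x
    proof -
      have "(\<Sum>b\<in>B. h2 b x * v (\<theta> b x)
         + (2 * h1 b x * D1 (\<theta> b) x + h b x * D2 (\<theta> b) x) * D1 v (\<theta> b x)) \<ge> 0"
        using h_nonneg vpos mem x rest
        by (intro sum_nonneg add_nonneg_nonneg mult_nonneg_nonneg[of "h2 _ _"])
           (auto intro: less_imp_le)
      then show ?thesis using eigen2[OF x] by simp
    qed
  qed (use eigen v(3) x in auto)
  \<comment> \<open>The terms \<open>h1 b u * v (\<theta> b u)\<close> and
    \<open>h2 b u * v (\<theta> b u)\<close>, dropped before, are now positive, and the remaining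
    ones are nonnegative. The argument is pointwise in \<open>u\<close>, so it covers every
    \<open>F\<close> at once.\<close>
  have strict: "D1 v u > 0 \<and> D2 v u > 0"
    if u: "u \<in> I" and g_strict: "\<And>b. b \<in> B \<Longrightarrow> D1 (g b) u > 0 \<and>
      D2 (g b) u * g b u - (1 - s) * (D1 (g b) u)\<^sup>2 > 0" for u
  proof -
    have pos': "h1 b u * v (\<theta> b u) > 0" "h2 b u * v (\<theta> b u) > 0" if b: "b \<in> B" for b
      using g_strict[OF b] s vpos[OF mem[OF b u]] pos[OF b u[unfolded I_def]]
      by (auto simp: h1_def h2_def)
    have "(\<Sum>b\<in>B. h1 b u * v (\<theta> b u)) > 0"
      using assms(2,3) pos' by (intro sum_pos)
    moreover have "(\<Sum>b\<in>B. h b u * D1 (\<theta> b) u * D1 v (\<theta> b u)) \<ge> 0"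
      using u mem by (intro sum_nonneg mult_nonneg_nonneg h_nonneg \<theta>1 v1) auto
    moreover have "(\<Sum>b\<in>B. h2 b u * v (\<theta> b u)
         + (2 * h1 b u * D1 (\<theta> b) u + h b u * D2 (\<theta> b) u) * D1 v (\<theta> b u)) > 0"
      using assms(2,3) pos' rest u by (intro sum_pos add_pos_nonneg)
    moreover have "(\<Sum>b\<in>B. h b u * (D1 (\<theta> b) u)\<^sup>2 * D2 v (\<theta> b u)) \<ge> 0"
      using u mem by (intro sum_nonneg mult_nonneg_nonneg h_nonneg v2) auto
    ultimately have "l * D1 v u > 0" "l * D2 v u > 0"
      unfolding eigen1[OF u] eigen2[OF u] by linarith+
    with l show ?thesis by (simp add: zero_less_mult_iff)
  qed
  show ?thesis
    unfolding I_def[symmetric] D1_def[symmetric] D2_def[symmetric]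
    using v1 v2 strict by (intro conjI allI impI ballI) auto
qed

end
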